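(* Let $\dot G=(G,\sigma)$ be a signed $(0,2)$-graph with spectrum $\{[-\lambda]^m,[-\mu]^1,[\mu]^1,[\lambda]^m\}$, where $m\geqslant1$ and $1\leqslant\mu<\lambda$. Then $G$ is the complete graph $K_4$.
   Context: A signed graph $\dot G=(G,\sigma)$ consists of a simple graph $G$ and $\sigma:E(G)\to\{1,-1\}$; its adjacency matrix is that of $G$ with entries of negative edges replaced by $-1$, and its spectrum is the multiset of eigenvalues of this matrix. A signed $(0,2)$-graph is a connected signed graph in which any two distinct vertices have exactly $0$ or $2$ common neighbours. The notation $[\nu]^k$ means eigenvalue $\nu$ with multiplicity $k$. *)

theory Defs
  imports
    "Graph_Theory.Kuratowski"
    "Jordan_Normal_Form.Char_Poly"
    "HOL-Computational_Algebra.Polynomial"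
begin

text \<open>
  As in \<^theory>\<open>Graph_Theory.Kuratowski\<close>, a finite simple graph is a loop-free symmetric digraph
  whose arcs are pairs of vertices: the edge \<open>uv\<close> is represented by the two arcs \<open>(u, v)\<close> and
  \<open>(v, u)\<close>. A signature is a function of the unordered pair \<open>{u, v}\<close>; only its values on edges
  matter.
\<close>

definition signed_graph :: "'a pair_pre_digraph \<Rightarrow> ('a set \<Rightarrow> int) \<Rightarrow> bool" where
  "signed_graph G \<sigma> \<longleftrightarrow> pair_graph G \<and> (\<forall>(u, v) \<in> parcs G. \<sigma> {u, v} \<in> {1, -1})"

definition common_neighbours :: "'a pair_pre_digraph \<Rightarrow> 'a \<Rightarrow> 'a \<Rightarrow> 'a set" where
  "common_neighbours G u v = {w \<in> pverts G. (u, w) \<in> parcs G \<and> (v, w) \<in> parcs G}"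

definition signed_02_graph :: "'a pair_pre_digraph \<Rightarrow> ('a set \<Rightarrow> int) \<Rightarrow> bool" where
  "signed_02_graph G \<sigma> \<longleftrightarrow>
     signed_graph G \<sigma> \<and> Digraph_Component.connected (with_proj G) \<and>
     (\<forall>u \<in> pverts G. \<forall>v \<in> pverts G. u \<noteq> v \<longrightarrow> card (common_neighbours G u v) \<in> {0, 2})"

definition adjacency_matrix ::
  "'a pair_pre_digraph \<Rightarrow> ('a set \<Rightarrow> int) \<Rightarrow> 'a list \<Rightarrow> real mat" where
  "adjacency_matrix G \<sigma> vs = Matrix.mat (length vs) (length vs)
     (\<lambda>(i, j). if (vs ! i, vs ! j) \<in> parcs G then of_int (\<sigma> {vs ! i, vs ! j}) else 0)"

text \<open>
  The eigenvalues are counted with algebraic multiplicity. The matrix is real symmetric, so this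
  agrees with the geometric multiplicity and no eigenvalue is lost by taking real roots only. The
  chosen ordering of the vertices is irrelevant, see \<open>signed_spectrum_eq\<close> below.
\<close>

definition signed_spectrum :: "'a pair_pre_digraph \<Rightarrow> ('a set \<Rightarrow> int) \<Rightarrow> real multiset" where
  "signed_spectrum G \<sigma> =
     proots (char_poly (adjacency_matrix G \<sigma> (SOME vs. distinct vs \<and> set vs = pverts G)))"

lemma char_poly_adjacency_matrix_cong:
  assumes vs: "distinct vs" and ws: "distinct ws" and eq: "set vs = set ws"
  shows "char_poly (adjacency_matrix G \<sigma> vs) = char_poly (adjacency_matrix G \<sigma> ws)"
proof -
  let ?n = "length vs"
  have len: "length ws = ?n"
    using vs ws eq by (metis distinct_card)
  have "mset vs = mset ws"
    using vs ws eq by (simp add: set_eq_iff_mset_eq_distinct)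
  then obtain p where p: "p permutes {..<length ws}" and vsp: "permute_list p ws = vs"
    by (metis mset_eq_permutation)
  have p': "p permutes {0..<?n}"
    using p len by (simp add: atLeast0LessThan)
  have pl: "p i < ?n" if "i < ?n" for i
    using permutes_in_image[OF p', of i] that by simp
  have nth: "vs ! i = ws ! p i" if "i < ?n" for i
    using vsp that p len by (metis permute_list_nth)
  let ?A = "adjacency_matrix G \<sigma> vs" and ?B = "adjacency_matrix G \<sigma> ws"
  let ?P = "Matrix.mat ?n ?n (\<lambda>(i, j). if j = p i then 1 else (0 :: real))"
  let ?Q = "Matrix.mat ?n ?n (\<lambda>(i, j). if i = p j then 1 else (0 :: real))"
  have inj: "p i = p j \<longleftrightarrow> i = j" for i j
    using permutes_inj[OF p'] by (auto dest: injD)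
  have PQ: "?P * ?Q = 1\<^sub>m ?n"
    by (rule eq_matI)
       (auto simp: scalar_prod_def if_distrib[of "\<lambda>x. x * _"] inj pl cong: if_cong)
  have QP: "?Q * ?P = 1\<^sub>m ?n"
    by (rule mat_mult_left_right_inverse[OF _ _ PQ]) auto
  have PB: "?P * ?B = Matrix.mat ?n ?n (\<lambda>(i, j). ?B $$ (p i, j))"
    by (rule eq_matI)
       (auto simp: adjacency_matrix_def len scalar_prod_def if_distrib[of "\<lambda>x. x * _"] pl
             cong: if_cong)
  have "?P * ?B * ?Q = ?A"
    unfolding PB
    by (rule eq_matI)
       (auto simp: scalar_prod_def if_distrib[of "\<lambda>x. _ * x"] pl adjacency_matrix_def len nth
             cong: if_cong)
  then have "similar_mat_wit ?A ?B ?P ?Q"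
    using PQ QP by (auto simp: similar_mat_wit_def Let_def adjacency_matrix_def len)
  then show ?thesis
    by (intro char_poly_similar) (auto simp: similar_mat_def)
qed

lemma signed_spectrum_eq:
  assumes "distinct vs" and "set vs = pverts G"
  shows "signed_spectrum G \<sigma> = proots (char_poly (adjacency_matrix G \<sigma> vs))"
proof -
  let ?ws = "SOME vs. distinct vs \<and> set vs = pverts G"
  have "distinct ?ws \<and> set ?ws = pverts G"
    by (rule someI[of _ vs]) (use assms in simp)
  then show ?thesis
    unfolding signed_spectrum_def
    using assms char_poly_adjacency_matrix_cong[of ?ws vs] by simp
qed

end

theory Submission
  imports Defs "Jordan_Normal_Form.Schur_Decomposition"
begin

text \<open>
  Put \<open>B = \<lambda>\<^sup>2 I - A\<^sup>2\<close> and \<open>\<delta> = \<lambda>\<^sup>2 - \<mu>\<^sup>2\<close>. Since \<open>A\<close> is symmetric, \<open>B\<^sup>2 = \<delta> B\<close>, so \<open>B\<close> is positive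
  semidefinite. A connected \<open>(0,2)\<close>-graph is regular, say of degree \<open>r\<close>, so \<open>B\<close> has constant diagonal
  \<open>b = \<lambda>\<^sup>2 - r\<close>, and its other entries lie in \<open>{0, 2, -2}\<close>. The trace of \<open>A\<^sup>2\<close> gives
  \<open>\<delta> = (m + 1) b\<close>, hence \<open>\<mu>\<^sup>2 = r - m b\<close>. A diagonal \<open>B\<close> would satisfy \<open>\<delta> = b\<close>, so some
  off-diagonal entry is \<open>2\<close> or \<open>-2\<close>, and semidefiniteness forces \<open>b \<ge> 2\<close>. Then \<open>1 \<le> \<mu>\<^sup>2 \<le> r - 2 m\<close>
  makes \<open>r\<close> at least \<open>2 m + 1\<close>, one less than the number of vertices: the graph is complete, and
  \<open>2 m\<close> common neighbours of two vertices must be \<open>2\<close>.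
\<close>

section \<open>Spectra of real symmetric matrices\<close>

definition mat_trace :: "'a :: comm_monoid_add mat \<Rightarrow> 'a" where
  "mat_trace A = (\<Sum>i<dim_row A. A $$ (i, i))"

lemma mat_mult_index_sum:
  fixes A B :: "'a :: semiring_0 mat"
  assumes "A \<in> carrier_mat n k" "B \<in> carrier_mat k l" "i < n" "j < l"
  shows "(A * B) $$ (i, j) = (\<Sum>x<k. A $$ (i, x) * B $$ (x, j))"
  using assms by (auto simp: scalar_prod_def atLeast0LessThan intro!: sum.cong)

lemma mat_trace_mult_commute:
  fixes A B :: "'a :: comm_semiring_0 mat"
  assumes A: "A \<in> carrier_mat n k" and B: "B \<in> carrier_mat k n"
  shows "mat_trace (A * B) = mat_trace (B * A)"
proof -
  have "mat_trace (A * B) = (\<Sum>i<n. \<Sum>x<k. A $$ (i, x) * B $$ (x, i))"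
    using A mat_mult_index_sum[OF A B] by (auto simp: mat_trace_def intro!: sum.cong)
  also have "\<dots> = (\<Sum>x<k. \<Sum>i<n. B $$ (x, i) * A $$ (i, x))"
    by (subst sum.swap) (simp add: mult.commute)
  also have "\<dots> = mat_trace (B * A)"
    using B mat_mult_index_sum[OF B A] by (auto simp: mat_trace_def intro!: sum.cong)
  finally show ?thesis .
qed

lemma mat_trace_similar:
  fixes A B :: "'a :: comm_ring_1 mat"
  assumes "similar_mat_wit A B P Q"
  shows "mat_trace A = mat_trace B"
proof -
  obtain n where n: "n = dim_row A" by simp
  note w = similar_mat_witD[OF n assms]
  have "mat_trace A = mat_trace ((P * B) * Q)" by (simp only: w(3))
  also have "\<dots> = mat_trace (Q * (P * B))"
    by (rule mat_trace_mult_commute) (use w(5-) in auto)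
  also have "Q * (P * B) = (Q * P) * B"
    by (rule assoc_mult_mat[symmetric]) (use w(5-) in auto)
  also have "\<dots> = B" using w(2,5) by simp
  finally show ?thesis .
qed

text \<open>The inner factor \<open>Q * P\<close> cancels. Keeping the same witnesses
  \<open>P\<close>, \<open>Q\<close> lets all polynomial expressions in one matrix be triangularised
  together.\<close>

lemma similar_mat_wit_mult:
  assumes "similar_mat_wit A B P Q" "similar_mat_wit A' B' P Q"
  shows "similar_mat_wit (A * A') (B * B') P Q"
proof -
  obtain n where d: "n = dim_row A" "n = dim_row A'"
    using assms by (auto simp: similar_mat_wit_def Let_def)
  note w = similar_mat_witD[OF d(1) assms(1)] and w' = similar_mat_witD[OF d(2) assms(2)]
  note [simp] = assoc_mult_mat[of _ n n _ n _ n]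
  have "A * A' = P * B * ((Q * P) * (B' * Q))"
    using w(5-) w'(5-) unfolding w(3) w'(3) by simp
  also have "\<dots> = P * (B * B') * Q"
    unfolding w(2) using w(5-) w'(5-) by simp
  finally have "A * A' = P * (B * B') * Q" .
  then show ?thesis
    by (rule similar_mat_witI[OF w(1,2)]) (use w(4-) w'(4-) in \<open>auto simp del: assoc_mult_mat\<close>)
qed

text \<open>Conjugation is additive and fixes scalar matrices.\<close>

lemma similar_mat_wit_scalar_minus:
  fixes A B :: "'a :: comm_ring_1 mat"
  assumes "similar_mat_wit A B P Q" and n: "n = dim_row A"
  shows "similar_mat_wit (s \<cdot>\<^sub>m 1\<^sub>m n - A) (s \<cdot>\<^sub>m 1\<^sub>m n - B) P Q"
proof -
  note w = similar_mat_witD[OF n assms(1)]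
  have "P * (s \<cdot>\<^sub>m 1\<^sub>m n - B) * Q = (P * (s \<cdot>\<^sub>m 1\<^sub>m n) - P * B) * Q"
    by (subst mult_minus_distrib_mat[of _ n n _ n]) (use w in auto)
  also have "\<dots> = P * (s \<cdot>\<^sub>m 1\<^sub>m n) * Q - P * B * Q"
    by (subst minus_mult_distrib_mat[of _ n n _ _ n]) (use w in auto)
  also have "P * (s \<cdot>\<^sub>m 1\<^sub>m n) * Q = s \<cdot>\<^sub>m 1\<^sub>m n"
    using w by (simp add: mult_smult_distrib[of _ n n _ n] mult_smult_assoc_mat[of _ n n _ n])
  finally have "s \<cdot>\<^sub>m 1\<^sub>m n - A = P * (s \<cdot>\<^sub>m 1\<^sub>m n - B) * Q"
    unfolding w(3)[symmetric] ..
  then show ?thesis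
    by (rule similar_mat_witI[OF w(1,2)]) (use w(4-) in auto)
qed

lemma
  fixes A B :: "'a :: semiring_0 mat"
  assumes A: "A \<in> carrier_mat n n" "upper_triangular A" and B: "B \<in> carrier_mat n n" "upper_triangular B"
  shows upper_triangular_mult: "upper_triangular (A * B)"
    and upper_triangular_mult_diag: "i < n \<Longrightarrow> (A * B) $$ (i, i) = A $$ (i, i) * B $$ (i, i)"
proof -
  \<comment> \<open>For \<open>x < i\<close> the first factor lies below the diagonal; otherwise
    \<open>x > j\<close> and the second one does.\<close>
  have z: "A $$ (i, x) * B $$ (x, j) = 0" if "i < n" "x < n" "j \<le> i" "x \<noteq> i \<or> j < i" for i j x
    using that upper_triangularD[OF A(2)] upper_triangularD[OF B(2)] A B
    by (cases "x < i") auto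
  show "upper_triangular (A * B)"
  proof
    fix i j assume "i < dim_row (A * B)" and ji: "j < i"
    then have ij: "i < n" "j < n" using A by auto
    show "(A * B) $$ (i, j) = 0"
      unfolding mat_mult_index_sum[OF A(1) B(1) ij] using ij ji z by (intro sum.neutral) auto
  qed
  show "(A * B) $$ (i, i) = A $$ (i, i) * B $$ (i, i)" if "i < n"
    using that z[of i _ i]
    by (simp add: mat_mult_index_sum[OF A(1) B(1)] sum.remove[of "{..<n}" i] del: index_mult_mat(1))
qed

lemma upper_triangular_scalar_minus:
  fixes A :: "'a :: comm_ring_1 mat"
  assumes "A \<in> carrier_mat n n" "upper_triangular A"
  shows "upper_triangular (s \<cdot>\<^sub>m 1\<^sub>m n - A)"
  using assms by (auto simp: upper_triangular_def)

text \<open>The squared entries of \<open>C\<close> add up to the trace of \<open>C\<^sup>2\<close>, which vanishes. This stands in for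
  diagonalisability, since the library's Schur decomposition does not export an orthogonal basis.\<close>

lemma symmetric_nilpotent_eq_0:
  fixes C :: "real mat"
  assumes C: "C \<in> carrier_mat n n" "C\<^sup>T = C"
    and sim: "similar_mat_wit C T P Q" and T: "upper_triangular T" "\<And>i. i < n \<Longrightarrow> T $$ (i, i) = 0"
  shows "C = 0\<^sub>m n n"
proof -
  have Tc: "T \<in> carrier_mat n n"
    using similar_mat_witD2[OF C(1) sim] by simp
  have sym: "C $$ (i, j) = C $$ (j, i)" if "i < n" "j < n" for i j
    using arg_cong[OF C(2), of "\<lambda>M. M $$ (i, j)"] that C(1) by simp
  have "(\<Sum>i<n. \<Sum>j<n. (C $$ (i, j))\<^sup>2) = mat_trace (C * C)"
    using C(1) sym by (auto simp: mat_trace_def mat_mult_index_sum[OF C(1) C(1)] power2_eq_square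
      simp del: index_mult_mat(1) intro!: sum.cong)
  also have "\<dots> = mat_trace (T * T)"
    by (rule mat_trace_similar[OF similar_mat_wit_mult[OF sim sim]])
  also have "\<dots> = 0"
    using Tc T upper_triangular_mult_diag[OF Tc T(1) Tc T(1)]
    by (auto simp: mat_trace_def simp del: index_mult_mat(1) intro!: sum.neutral)
  finally have "\<forall>i<n. \<forall>j<n. C $$ (i, j) = 0"
    by (simp add: sum_nonneg_eq_0_iff sum_nonneg)
  then show ?thesis
    using C by (intro eq_matI) auto
qed

section \<open>Real eigenvalues and the triangular form of a symmetric matrix\<close>

text \<open>The polynomial splits over the complex numbers. At an eigenvector for the root
  \<open>a\<close>, the Hermitian form of \<open>A\<close> is real by symmetry and equals
  \<open>a\<close> times a positive number, so \<open>a\<close> is real.\<close>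

lemma symmetric_real_char_poly_splits:
  fixes A :: "real mat"
  assumes A: "A \<in> carrier_mat n n" "A\<^sup>T = A"
  shows "\<exists>es. char_poly A = (\<Prod>e\<leftarrow>es. [:- e, 1:]) \<and> length es = n"
proof -
  interpret h: map_poly_inj_idom_hom complex_of_real ..
  let ?A = "map_mat complex_of_real A"
  have Ac: "?A \<in> carrier_mat n n" using A by auto
  have sym: "A $$ (i, j) = A $$ (j, i)" if "i < n" "j < n" for i j
    using arg_cong[OF A(2), of "\<lambda>M. M $$ (i, j)"] that A(1) by simp
  obtain as where as: "char_poly ?A = (\<Prod>a\<leftarrow>as. [:- a, 1:])" "length as = n"
    using char_poly_factorized[OF Ac] by blast
  have real: "Im a = 0" if "a \<in> set as" for a
  proof -
    have "eigenvalue ?A a"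
      using that by (auto simp: eigenvalue_root_char_poly[OF Ac] as poly_prod_list prod_list_zero_iff)
    then obtain v where v: "v \<in> carrier_vec n" "v \<noteq> 0\<^sub>v n" "?A *\<^sub>v v = a \<cdot>\<^sub>v v"
      using Ac by (auto simp: eigenvalue_def eigenvector_def)
    let ?N = "\<Sum>i<n. (cmod (v $ i))\<^sup>2"
    have row: "(\<Sum>j<n. of_real (A $$ (i, j)) * v $ j) = a * v $ i" if "i < n" for i
      using arg_cong[OF v(3), of "\<lambda>w. w $ i"] that v(1) A(1)
      by (auto simp: scalar_prod_def atLeast0LessThan)
    \<comment> \<open>The Hermitian form of \<open>A\<close> at \<open>v\<close>.\<close>
    define q where "q = (\<Sum>i<n. \<Sum>j<n. cnj (v $ i) * (of_real (A $$ (i, j)) * v $ j))"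
    have "q = (\<Sum>i<n. cnj (v $ i) * (a * v $ i))"
      unfolding q_def by (simp add: row flip: sum_distrib_left)
    also have "\<dots> = a * of_real ?N"
      unfolding of_real_sum complex_norm_square by (simp add: sum_distrib_left mult_ac)
    finally have q: "q = a * of_real ?N" .
    \<comment> \<open>The entries of \<open>A\<close> are real, so conjugation affects only
      \<open>v\<close>; swapping the sums and using symmetry gives back \<open>q\<close>.\<close>
    have "cnj q = (\<Sum>j<n. \<Sum>i<n. v $ i * (of_real (A $$ (i, j)) * cnj (v $ j)))"
      unfolding q_def by (subst sum.swap) simp
    also have "\<dots> = q"
      unfolding q_def by (auto intro!: sum.cong simp: sym mult_ac)
    finally have "Im q = 0"
      by (simp add: complex_eq_iff)
    then have "Im a * ?N = 0"
      unfolding q by (simp del: of_real_sum of_real_power)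
    moreover have "?N \<noteq> 0"
    proof
      assume "?N = 0"
      then have "\<forall>i<n. v $ i = 0" by (simp add: sum_nonneg_eq_0_iff)
      with v show False by (auto intro!: eq_vecI)
    qed
    ultimately show ?thesis by simp
  qed
  let ?es = "map Re as"
  \<comment> \<open>Since all roots are real, each linear factor is the image of a real one, and
    injectivity of the embedding carries the factorisation back to the reals.\<close>
  have "map (\<lambda>a. [:- a, 1:]) as = map (map_poly complex_of_real \<circ> (\<lambda>e. [:- e, 1:]) \<circ> Re) as"
    using real by (intro map_cong refl) (simp add: complex_eq_iff)
  then have "char_poly ?A = map_poly complex_of_real (\<Prod>e\<leftarrow>?es. [:- e, 1:])"
    unfolding as(1) by (simp only: h.hom_prod_list map_map o_assoc)
  then have "char_poly A = (\<Prod>e\<leftarrow>?es. [:- e, 1:])"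
    using of_real_hom.char_poly_hom[OF A(1), where ?'a = complex] by simp
  with as(2) show ?thesis by (intro exI[of _ ?es]) simp
qed

text \<open>Similar matrices share their characteristic polynomial, and a triangular one shows its
  roots on the diagonal.\<close>

lemma proots_char_poly_similar_upper_triangular:
  fixes T :: "'a :: idom mat"
  assumes "similar_mat_wit A T P Q" "T \<in> carrier_mat n n" "upper_triangular T"
  shows "proots (char_poly A) = mset (diag_mat T)"
proof -
  have "char_poly A = (\<Prod>e\<leftarrow>diag_mat T. [:- e, 1:])"
    using assms char_poly_similar[of A T] char_poly_upper_triangular[of T n] by (auto simp: similar_mat_def)
  moreover have "proots (\<Prod>e\<leftarrow>es. [:- e, 1:]) = mset es" for es :: "'a list"
  proof (induction es)
    case (Cons e es)
    have "(\<Prod>e\<leftarrow>es. [:- e, 1:]) \<noteq> 0" by (auto simp: prod_list_zero_iff)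
    then have "proots ([:- e, 1:] * (\<Prod>e\<leftarrow>es. [:- e, 1:])) =
        proots [:- e, 1:] + proots (\<Prod>e\<leftarrow>es. [:- e, 1:])"
      by (intro proots_mult) auto
    then show ?case by (simp add: Cons.IH del: mult_pCons_left)
  qed simp
  ultimately show ?thesis by simp
qed

text \<open>A Schur decomposition over the reals needs real linear factors, which symmetry
  provides.\<close>

lemma symmetric_real_triangularisable:
  fixes A :: "real mat"
  assumes A: "A \<in> carrier_mat n n" "A\<^sup>T = A"
  obtains T P Q where "similar_mat_wit A T P Q" "T \<in> carrier_mat n n" "upper_triangular T"
proof -
  obtain es where "char_poly A = (\<Prod>e\<leftarrow>es. [:- e, 1:])"
    using symmetric_real_char_poly_splits[OF A] by blast
  from schur_decomposition_exists[OF A(1) this] that show ?thesis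
    by (auto simp: similar_mat_def)
qed

text \<open>Both products expand to the same expression, symmetric in \<open>s\<close> and
  \<open>t\<close>. Applied to \<open>M = A * A\<close>, this makes the product of two symmetric
  factors symmetric.\<close>

lemma scalar_minus_mult_commute:
  fixes M :: "'a :: comm_ring_1 mat"
  assumes M: "M \<in> carrier_mat n n"
  shows "(s \<cdot>\<^sub>m 1\<^sub>m n - M) * (t \<cdot>\<^sub>m 1\<^sub>m n - M) = (t \<cdot>\<^sub>m 1\<^sub>m n - M) * (s \<cdot>\<^sub>m 1\<^sub>m n - M)"
proof -
  have "(s \<cdot>\<^sub>m 1\<^sub>m n - M) * (t \<cdot>\<^sub>m 1\<^sub>m n - M) =
      (s \<cdot>\<^sub>m (t \<cdot>\<^sub>m 1\<^sub>m n) - t \<cdot>\<^sub>m M) - (s \<cdot>\<^sub>m M - M * M)" for s t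
  proof -
    have "(s \<cdot>\<^sub>m 1\<^sub>m n - M) * (t \<cdot>\<^sub>m 1\<^sub>m n - M) =
        (s \<cdot>\<^sub>m 1\<^sub>m n - M) * (t \<cdot>\<^sub>m 1\<^sub>m n) - (s \<cdot>\<^sub>m 1\<^sub>m n - M) * M"
      by (rule mult_minus_distrib_mat[of _ n n _ n]) (use M in auto)
    also have "(s \<cdot>\<^sub>m 1\<^sub>m n - M) * (t \<cdot>\<^sub>m 1\<^sub>m n) = s \<cdot>\<^sub>m (t \<cdot>\<^sub>m 1\<^sub>m n) - t \<cdot>\<^sub>m M"
      using M by (auto simp: mult_smult_distrib[of _ n n _ n] algebra_simps intro!: eq_matI)
    also have "(s \<cdot>\<^sub>m 1\<^sub>m n - M) * M = s \<cdot>\<^sub>m M - M * M"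
      using M by (simp add: minus_mult_distrib_mat[of _ n n _ _ n] mult_smult_assoc_mat[of _ n n _ n])
    finally show ?thesis .
  qed
  then show ?thesis
    using M by (auto intro!: eq_matI simp: algebra_simps simp del: index_mult_mat(1))
qed

text \<open>All three are read off the diagonal of one triangular form \<open>T\<close>, which lists
  the eigenvalues with multiplicity. For the last, the product taken at \<open>T\<close> is
  triangular with zero diagonal, and the product at \<open>A\<close> is symmetric because its
  factors commute, so it vanishes. Only squares of eigenvalues enter, so two values
  \<open>s\<close>, \<open>t\<close> cover the four eigenvalues of the theorem.\<close>

lemma
  fixes A :: "real mat"
  assumes A: "A \<in> carrier_mat n n" "A\<^sup>T = A"
  shows size_proots_char_poly_symmetric: "size (proots (char_poly A)) = n"
    and mat_trace_square_symmetric: "mat_trace (A * A) = (\<Sum>e\<in>#proots (char_poly A). e\<^sup>2)"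
    and symmetric_square_minimal_poly:
      "(\<And>e. e \<in># proots (char_poly A) \<Longrightarrow> e\<^sup>2 = s \<or> e\<^sup>2 = t) \<Longrightarrow>
        (s \<cdot>\<^sub>m 1\<^sub>m n - A * A) * (t \<cdot>\<^sub>m 1\<^sub>m n - A * A) = 0\<^sub>m n n"
proof -
  obtain T P Q where sim: "similar_mat_wit A T P Q" and T: "T \<in> carrier_mat n n" "upper_triangular T"
    using symmetric_real_triangularisable[OF A] by blast
  have p: "proots (char_poly A) = mset (diag_mat T)"
    by (rule proots_char_poly_similar_upper_triangular[OF sim T])
  show "size (proots (char_poly A)) = n"
    using T p by (simp add: diag_mat_def)
  have "mat_trace (A * A) = mat_trace (T * T)"
    by (rule mat_trace_similar[OF similar_mat_wit_mult[OF sim sim]])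
  also have "\<dots> = (\<Sum>i<n. (T $$ (i, i))\<^sup>2)"
    using T upper_triangular_mult_diag[OF T T]
    by (auto simp: mat_trace_def power2_eq_square simp del: index_mult_mat(1) intro!: sum.cong)
  also have "\<dots> = (\<Sum>e\<in>#proots (char_poly A). e\<^sup>2)"
    using T by (simp add: p diag_mat_def o_def sum_mset_sum_list interv_sum_list_conv_sum_set_nat
        atLeast0LessThan flip: mset_map)
  finally show "mat_trace (A * A) = (\<Sum>e\<in>#proots (char_poly A). e\<^sup>2)" .
  let ?S = "\<lambda>s A :: real mat. s \<cdot>\<^sub>m 1\<^sub>m n - A * A"
  assume st: "\<And>e. e \<in># proots (char_poly A) \<Longrightarrow> e\<^sup>2 = s \<or> e\<^sup>2 = t"
  have TT: "T * T \<in> carrier_mat n n" "upper_triangular (T * T)"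
    using T upper_triangular_mult[OF T T] by auto
  have S: "?S r T \<in> carrier_mat n n" "upper_triangular (?S r T)" for r
    using T upper_triangular_scalar_minus[OF TT] by auto
  have simS: "similar_mat_wit (?S r A) (?S r T) P Q" for r
    by (rule similar_mat_wit_scalar_minus[OF similar_mat_wit_mult[OF sim sim]]) (use A in auto)
  have Sc: "?S r A \<in> carrier_mat n n" for r
    using A by auto
  have comm: "?S s A * ?S t A = ?S t A * ?S s A"
    by (rule scalar_minus_mult_commute) (use A in auto)
  have tS: "(?S r A)\<^sup>T = ?S r A" for r
    using A transpose_mult[OF A(1) A(1)]
    by (auto intro!: eq_matI simp: transpose_minus simp del: index_mult_mat(1))
       (metis index_mult_mat(2,3) index_transpose_mat(1) carrier_matD)
  show "?S s A * ?S t A = 0\<^sub>m n n"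
  proof (rule symmetric_nilpotent_eq_0)
    show "?S s A * ?S t A \<in> carrier_mat n n" using A by auto
    show "(?S s A * ?S t A)\<^sup>T = ?S s A * ?S t A"
      unfolding transpose_mult[OF Sc Sc] tS comm ..
    show "similar_mat_wit (?S s A * ?S t A) (?S s T * ?S t T) P Q"
      by (rule similar_mat_wit_mult[OF simS simS])
    show "upper_triangular (?S s T * ?S t T)"
      by (rule upper_triangular_mult[OF S S])
    fix i assume i: "i < n"
    have "T $$ (i, i) \<in># proots (char_poly A)"
      using i T by (simp add: p diag_mat_def)
    from st[OF this] show "(?S s T * ?S t T) $$ (i, i) = 0"
      unfolding upper_triangular_mult_diag[OF S S i]
      using i T upper_triangular_mult_diag[OF T T i]
      by (auto simp: power2_eq_square simp del: index_mult_mat(1))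
  qed
qed

section \<open>Signed (0,2)-graphs\<close>

text \<open>An entry of the adjacency matrix, indexed by vertices so that the graph arguments need
  no ordering.\<close>

definition arc_sign :: "'a pair_pre_digraph \<Rightarrow> ('a set \<Rightarrow> int) \<Rightarrow> 'a \<Rightarrow> 'a \<Rightarrow> real" where
  "arc_sign G \<sigma> u v = (if (u, v) \<in> parcs G then of_int (\<sigma> {u, v}) else 0)"

text \<open>An entry of the squared adjacency matrix: walks of length two, weighted by the product
  of their signs.\<close>

definition signed_walks2 :: "'a pair_pre_digraph \<Rightarrow> ('a set \<Rightarrow> int) \<Rightarrow> 'a \<Rightarrow> 'a \<Rightarrow> real" where
  "signed_walks2 G \<sigma> u v = (\<Sum>w\<in>pverts G. arc_sign G \<sigma> u w * arc_sign G \<sigma> w v)"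

abbreviation nbrs :: "'a pair_pre_digraph \<Rightarrow> 'a \<Rightarrow> 'a set" where
  "nbrs G u \<equiv> {w. (u, w) \<in> parcs G}"

context
  fixes G :: "'a pair_pre_digraph" and \<sigma> :: "'a set \<Rightarrow> int"
  assumes G: "signed_02_graph G \<sigma>"
begin

lemma pair_graph_signed_02: "pair_graph G"
  using G by (simp add: signed_02_graph_def signed_graph_def)

interpretation pair_graph G
  by (rule pair_graph_signed_02)

lemma arcs_sym: "(u, v) \<in> parcs G \<longleftrightarrow> (v, u) \<in> parcs G"
  using pair_sym_arcs by (auto simp: symmetric_def sym_def)

lemma arc_sign_commute: "arc_sign G \<sigma> u v = arc_sign G \<sigma> v u"
  using arcs_sym[of u v] by (simp add: arc_sign_def insert_commute)

lemma arc_sign_cases: "(u, v) \<in> parcs G \<Longrightarrow> arc_sign G \<sigma> u v = 1 \<or> arc_sign G \<sigma> u v = -1"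
  using G by (force simp: signed_02_graph_def signed_graph_def arc_sign_def)

lemma signed_walks2_commute: "signed_walks2 G \<sigma> u v = signed_walks2 G \<sigma> v u"
  unfolding signed_walks2_def
  by (rule sum.cong) (simp_all add: arc_sign_commute[of u] arc_sign_commute[of v])

lemma nbrs_subset: "nbrs G u \<subseteq> pverts G - {u}"
  using pair_no_loops wellformed' by fastforce

text \<open>Going along an edge and back contributes the square of its sign, which is 1.\<close>

lemma signed_walks2_self: "signed_walks2 G \<sigma> u u = card (nbrs G u)"
proof -
  have "signed_walks2 G \<sigma> u u = (\<Sum>w\<in>nbrs G u. arc_sign G \<sigma> u w * arc_sign G \<sigma> w u)"
    unfolding signed_walks2_def
    using nbrs_subset pair_finite_verts by (intro sum.mono_neutral_right) (auto simp: arc_sign_def)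
  also have "\<dots> = (\<Sum>w\<in>nbrs G u. 1)"
    using arc_sign_cases by (intro sum.cong refl) (force simp: arc_sign_commute[of _ u])
  finally show ?thesis by simp
qed

lemma card_common_neighbours:
  "u \<in> pverts G \<Longrightarrow> v \<in> pverts G \<Longrightarrow> u \<noteq> v \<Longrightarrow>
    card (common_neighbours G u v) = 0 \<or> card (common_neighbours G u v) = 2"
  using G by (auto simp: signed_02_graph_def)

text \<open>Each of the at most two common neighbours contributes 1 or -1; two contributions add up
  or cancel.\<close>

lemma signed_walks2_distinct:
  assumes "u \<in> pverts G" "v \<in> pverts G" "u \<noteq> v"
  shows "signed_walks2 G \<sigma> u v \<in> {0, 2, -2}"
proof -
  let ?C = "common_neighbours G u v"
  have fin: "finite ?C"
    using pair_finite_verts by (simp add: common_neighbours_def)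
  have eq: "signed_walks2 G \<sigma> u v = (\<Sum>w\<in>?C. arc_sign G \<sigma> u w * arc_sign G \<sigma> w v)"
    unfolding signed_walks2_def using pair_finite_verts arcs_sym
    by (intro sum.mono_neutral_right) (auto simp: arc_sign_def common_neighbours_def)
  have pm: "arc_sign G \<sigma> u w * arc_sign G \<sigma> w v \<in> {1, -1}" if "w \<in> ?C" for w
    using that arc_sign_cases[of u w] arc_sign_cases[of v w]
    by (auto simp: common_neighbours_def arc_sign_commute[of w])
  from card_common_neighbours[OF assms] show ?thesis
  proof
    assume "card ?C = 0"
    with fin show ?thesis by (simp add: eq)
  next
    assume "card ?C = 2"
    then obtain x y where xy: "?C = {x, y}" "x \<noteq> y"
      by (auto simp: card_2_iff)
    with pm[of x] pm[of y] show ?thesis by (auto simp: eq)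
  qed
qed

section \<open>Regularity of connected (0,2)-graphs\<close>

lemma common_neighbours_other:
  assumes "u \<in> pverts G" "v \<in> pverts G" "u \<noteq> v" "x \<in> common_neighbours G u v"
  shows "\<exists>!y. y \<in> common_neighbours G u v \<and> y \<noteq> x"
proof -
  have "finite (common_neighbours G u v)"
    using pair_finite_verts by (simp add: common_neighbours_def)
  then have "card (common_neighbours G u v) = 2"
    using card_common_neighbours[OF assms(1-3)] assms(4) by auto
  with assms(4) show ?thesis by (auto simp: card_2_iff)
qed

text \<open>Sending \<open>w\<close> to the second common neighbour of \<open>v\<close> and \<open>w\<close> (the first one being \<open>u\<close>)
  embeds the neighbours of \<open>u\<close> other than \<open>v\<close> into the neighbours of \<open>v\<close> other than \<open>u\<close>.\<close>

lemma card_nbrs_le: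
  assumes uv: "(u, v) \<in> parcs G"
  shows "card (nbrs G u) \<le> card (nbrs G v)"
proof -
  have V: "u \<in> pverts G" "v \<in> pverts G" "u \<noteq> v" and vu: "(v, u) \<in> parcs G"
    using uv wellformed' pair_no_loops arcs_sym by fastforce+
  have fin: "finite (nbrs G x)" for x
    using nbrs_subset pair_finite_verts by (meson finite_Diff finite_subset)
  have C: "x \<in> common_neighbours G y z \<longleftrightarrow> (y, x) \<in> parcs G \<and> (z, x) \<in> parcs G" for x y z
    using wellformed' by (auto simp: common_neighbours_def)
  define f where "f w = (THE y. y \<in> common_neighbours G v w \<and> y \<noteq> u)" for w
  have f: "(v, f w) \<in> parcs G \<and> (w, f w) \<in> parcs G \<and> f w \<noteq> u" if "w \<in> nbrs G u - {v}" for w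
  proof -
    have "\<exists>!y. y \<in> common_neighbours G v w \<and> y \<noteq> u"
      using that V vu arcs_sym wellformed' by (intro common_neighbours_other) (auto simp: C)
    from theI'[OF this] show ?thesis by (simp add: f_def C)
  qed
  have "inj_on f (nbrs G u - {v})"
  proof
    fix w w' assume w: "w \<in> nbrs G u - {v}" and w': "w' \<in> nbrs G u - {v}" and eq: "f w = f w'"
    \<comment> \<open>Both \<open>v\<close> and \<open>w\<close> are common neighbours of
      \<open>u\<close> and \<open>f w\<close>, so \<open>w\<close> is recovered from
      \<open>f w\<close> as the one other than \<open>v\<close>.\<close>
    have "\<exists>!y. y \<in> common_neighbours G u (f w) \<and> y \<noteq> v"
      using f[OF w] V uv arcs_sym wellformed' by (intro common_neighbours_other) (auto simp: C)
    moreover have "w \<in> common_neighbours G u (f w)" "w' \<in> common_neighbours G u (f w)"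
      using w w' f[OF w] f[OF w'] eq arcs_sym by (auto simp: C)
    ultimately show "w = w'" using w w' by blast
  qed
  moreover have "f ` (nbrs G u - {v}) \<subseteq> nbrs G v - {u}"
    using f by auto
  ultimately have "card (nbrs G u - {v}) \<le> card (nbrs G v - {u})"
    using fin by (intro card_inj_on_le) auto
  moreover have "card (nbrs G u) = Suc (card (nbrs G u - {v}))"
    by (rule card.remove[OF fin]) (simp add: uv)
  moreover have "card (nbrs G v) = Suc (card (nbrs G v - {u}))"
    by (rule card.remove[OF fin]) (simp add: vu)
  ultimately show ?thesis by linarith
qed

text \<open>The inequality holds along both arcs of an edge, so adjacent vertices have equal
  degrees; connectedness spreads this over the graph.\<close>

lemma card_nbrs_eq:
  assumes "u \<in> pverts G" "v \<in> pverts G"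
  shows "card (nbrs G u) = card (nbrs G v)"
proof -
  have step: "card (nbrs G x) = card (nbrs G y)" if "(x, y) \<in> parcs G" for x y
    using that card_nbrs_le[of x y] card_nbrs_le[of y x] arcs_sym by auto
  \<comment> \<open>Connectedness is defined through the symmetrised digraph; the arcs are already
    symmetric, so reachability there is reachability in \<open>G\<close>.\<close>
  have "u \<rightarrow>\<^sup>*\<^bsub>with_proj (mk_symmetric (with_proj G))\<^esub> v"
    using G assms by (auto simp: signed_02_graph_def connected_def)
  then have "u \<rightarrow>\<^sup>*\<^bsub>with_proj G\<^esub> v"
    using reachable_mk_symmetric_eq pair_sym_arcs by simp
  then have "(u, v) \<in> rtrancl_on (pverts G) (parcs G)"
    by (simp add: reachable_def)
  then show ?thesis
    by (induction rule: rtrancl_on.induct) (use step in auto)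
qed

end

section \<open>Entries of a positive semidefinite matrix\<close>

text \<open>By symmetry and \<open>sq\<close>, the inner product of two rows is \<open>d\<close>
  times an entry. The squared norm of row \<open>u\<close> plus \<open>c\<close> times row
  \<open>v\<close>, with \<open>c\<close> being 1 or -1, is therefore
  \<open>2 * d * (b + c * B u v)\<close>, and it is nonnegative.\<close>

lemma diagonal_ge_offdiagonal:
  fixes B :: "'a \<Rightarrow> 'a \<Rightarrow> real"
  assumes V: "finite V" "u \<in> V" "v \<in> V"
    and sym: "\<And>u v. B u v = B v u"
    and diag: "B u u = b" "B v v = b"
    and sq: "\<And>u w. u \<in> V \<Longrightarrow> w \<in> V \<Longrightarrow> (\<Sum>v\<in>V. B u v * B v w) = d * B u w"
    and d: "d > 0"
  shows "\<bar>B u v\<bar> \<le> b"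
proof -
  have "0 \<le> 2 * d * b + 2 * c * d * B u v" if "c\<^sup>2 = 1" for c
  proof -
    have "0 \<le> (\<Sum>x\<in>V. (B u x + c * B v x)\<^sup>2)"
      by (simp add: sum_nonneg)
    also have "\<dots> = (\<Sum>x\<in>V. B u x * B x u) + 2 * c * (\<Sum>x\<in>V. B u x * B x v)
        + c\<^sup>2 * (\<Sum>x\<in>V. B v x * B x v)"
      by (simp add: sum_distrib_left power2_eq_square algebra_simps sum.distrib sym[of _ u] sym[of _ v])
    also have "\<dots> = 2 * d * b + 2 * c * d * B u v"
      using V diag that by (simp add: sq)
    finally show ?thesis .
  qed
  from this[of 1] this[of "-1"] have "d * B u v \<le> d * b" "d * (- B u v) \<le> d * b" by auto
  with d have "B u v \<le> b" "- B u v \<le> b"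
    by (simp_all only: mult_le_cancel_left_pos)
  then show ?thesis by (simp add: abs_le_iff)
qed

section \<open>From matrix positions to vertices\<close>

lemma sum_set_nth:
  assumes "distinct vs"
  shows "(\<Sum>v\<in>set vs. f v) = (\<Sum>i<length vs. f (vs ! i))"
  using sum.reindex_bij_betw[OF bij_betw_nth[OF assms refl refl], of f] by simp

lemma
  assumes "distinct vs" "set vs = pverts G"
  shows adjacency_matrix_square:
      "i < length vs \<Longrightarrow> j < length vs \<Longrightarrow>
        (adjacency_matrix G \<sigma> vs * adjacency_matrix G \<sigma> vs) $$ (i, j) =
          signed_walks2 G \<sigma> (vs ! i) (vs ! j)"
    and mat_trace_adjacency_matrix_square:
      "mat_trace (adjacency_matrix G \<sigma> vs * adjacency_matrix G \<sigma> vs) =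
        (\<Sum>v\<in>pverts G. signed_walks2 G \<sigma> v v)"
proof -
  let ?A = "adjacency_matrix G \<sigma> vs"
  have A: "?A \<in> carrier_mat (length vs) (length vs)"
    by (simp add: adjacency_matrix_def)
  show AA: "(?A * ?A) $$ (i, j) = signed_walks2 G \<sigma> (vs ! i) (vs ! j)"
    if "i < length vs" "j < length vs" for i j
    unfolding mat_mult_index_sum[OF A A that] signed_walks2_def assms(2)[symmetric] sum_set_nth[OF assms(1)]
    using that by (intro sum.cong) (auto simp: adjacency_matrix_def arc_sign_def)
  show "mat_trace (?A * ?A) = (\<Sum>v\<in>pverts G. signed_walks2 G \<sigma> v v)"
    unfolding assms(2)[symmetric] sum_set_nth[OF assms(1)]
    using A by (auto simp: mat_trace_def AA simp del: index_mult_mat(1) intro!: sum.cong)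
qed

lemma adjacency_matrix_symmetric:
  assumes "signed_02_graph G \<sigma>"
  shows "(adjacency_matrix G \<sigma> vs)\<^sup>T = adjacency_matrix G \<sigma> vs"
  using arcs_sym[OF assms] by (auto simp: adjacency_matrix_def insert_commute intro!: eq_matI)

section \<open>From the spectrum to the complete graph\<close>

theorem theorem6p3:
  fixes G :: "'a pair_pre_digraph" and \<sigma> :: "'a set \<Rightarrow> int"
    and lam mu :: real and m :: nat
  assumes "signed_02_graph G \<sigma>"
    and "signed_spectrum G \<sigma> =
      replicate_mset m (- lam) + replicate_mset 1 (- mu) + replicate_mset 1 mu + replicate_mset m lam"
    and "m \<ge> 1"
    and "1 \<le> mu" and "mu < lam"
  shows "K\<^bsub>4\<^esub> (with_proj G)"
proof -
  note G = assms(1)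
  interpret pair_graph G by (rule pair_graph_signed_02[OF G])
  obtain vs where vs: "distinct vs" "set vs = pverts G"
    using finite_distinct_list[OF pair_finite_verts] by blast
  define A where "A = adjacency_matrix G \<sigma> vs"
  define n where "n = length vs"
  have A: "A \<in> carrier_mat n n" "A\<^sup>T = A"
    using adjacency_matrix_symmetric[OF G] by (auto simp: A_def n_def adjacency_matrix_def)
  have spec: "proots (char_poly A) =
      replicate_mset m (- lam) + replicate_mset 1 (- mu) + replicate_mset 1 mu + replicate_mset m lam"
    using assms(2) signed_spectrum_eq[OF vs] by (simp add: A_def)
  have n: "n = 2 * m + 2"
    using size_proots_char_poly_symmetric[OF A] by (simp add: spec)
  have card: "card (pverts G) = n"
    using vs by (simp add: n_def distinct_card[symmetric])
  let ?M = "signed_walks2 G \<sigma>"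
  have AA: "(A * A) $$ (i, j) = ?M (vs ! i) (vs ! j)" if "i < n" "j < n" for i j
    using adjacency_matrix_square[OF vs] that by (simp add: A_def n_def)
  obtain v0 where v0: "v0 \<in> pverts G"
    using card n by fastforce
  define r where "r = card (nbrs G v0)"
  have reg: "card (nbrs G u) = r" if "u \<in> pverts G" for u
    unfolding r_def by (rule card_nbrs_eq[OF G that v0])
  define b where "b = lam\<^sup>2 - r"
  define d where "d = lam\<^sup>2 - mu\<^sup>2"
  define B where "B u v = (if u = v then lam\<^sup>2 else 0) - ?M u v" for u v
  have d: "d > 0"
    using assms(4,5) by (simp add: d_def power2_strict_mono)
  have "real n * r = (\<Sum>v\<in>pverts G. ?M v v)"
    by (simp add: signed_walks2_self[OF G] reg card)
  also have "\<dots> = (\<Sum>e\<in>#proots (char_poly A). e\<^sup>2)"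
    using mat_trace_square_symmetric[OF A] mat_trace_adjacency_matrix_square[OF vs] by (simp add: A_def)
  also have "\<dots> = 2 * m * lam\<^sup>2 + 2 * mu\<^sup>2"
    by (simp add: spec)
  \<comment> \<open>With \<open>n = 2 * m + 2\<close>, halving the trace identity gives
    \<open>(m + 1) * r = m * lam\<^sup>2 + mu\<^sup>2\<close>; subtract this from
    \<open>(m + 1) * lam\<^sup>2\<close>.\<close>
  finally have db: "d = (real m + 1) * b"
    by (simp add: d_def b_def n algebra_simps)
  with d have b: "b > 0" by (simp add: zero_less_mult_iff)
  have Bsym: "B u v = B v u" for u v
    by (simp add: B_def signed_walks2_commute[OF G, of u])
  have Bdiag: "B u u = b" if "u \<in> pverts G" for u
    using that by (simp add: B_def b_def signed_walks2_self[OF G] reg)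
  have Boff: "B u v \<in> {0, 2, -2}" if "u \<in> pverts G" "v \<in> pverts G" "u \<noteq> v" for u v
    using signed_walks2_distinct[OF G that] that(3) by (auto simp: B_def)
  have Bsq: "(\<Sum>v\<in>pverts G. B u v * B v w) = d * B u w" if uw: "u \<in> pverts G" "w \<in> pverts G" for u w
  proof -
    obtain i j where i: "i < n" "u = vs ! i" and j: "j < n" "w = vs ! j"
      using uw vs by (metis in_set_conv_nth n_def)
    let ?S = "\<lambda>s. s \<cdot>\<^sub>m 1\<^sub>m n - A * A"
    have S: "?S s \<in> carrier_mat n n" for s using A by auto
    \<comment> \<open>The first factor is \<open>B\<close> and the second is \<open>B - d I\<close>,
      so their vanishing product says \<open>B\<^sup>2 = d B\<close>.\<close>
    have S1: "?S (lam\<^sup>2) $$ (i, j) = B (vs ! i) (vs ! j)"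
      and S2: "?S (mu\<^sup>2) $$ (i, j) = B (vs ! i) (vs ! j) - (if i = j then d else 0)"
      if "i < n" "j < n" for i j
      using that A vs(1) by (simp_all add: AA B_def d_def n_def nth_eq_iff_index_eq del: index_mult_mat(1))
    have "(?S (lam\<^sup>2) * ?S (mu\<^sup>2)) $$ (i, j) = 0"
      using i j by (subst symmetric_square_minimal_poly[OF A]) (auto simp: spec split: if_splits)
    then have "0 = (\<Sum>x<n. B u (vs ! x) * (B (vs ! x) w - (if x = j then d else 0)))"
      unfolding mat_mult_index_sum[OF S S i(1) j(1)] using i j by (simp add: S1 S2)
    also have "\<dots> = (\<Sum>x<n. B u (vs ! x) * B (vs ! x) w) - (\<Sum>x<n. if x = j then d * B u (vs ! x) else 0)"
      unfolding sum_subtractf[symmetric] by (intro sum.cong) (auto simp: algebra_simps)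
    also have "\<dots> = (\<Sum>v\<in>pverts G. B u v * B v w) - d * B u w"
      using j unfolding vs(2)[symmetric] sum_set_nth[OF vs(1)] by (simp add: n_def)
    finally show ?thesis by simp
  qed
  \<comment> \<open>Otherwise the \<open>(v0, v0)\<close> entry of \<open>B\<^sup>2 = d B\<close>
    would give \<open>d = b\<close>, against \<open>d = (m + 1) * b\<close> with
    \<open>b > 0\<close> and \<open>m \<ge> 1\<close>.\<close>
  have "\<exists>v\<in>pverts G. v \<noteq> v0 \<and> B v0 v \<noteq> 0"
  proof (rule ccontr)
    assume "\<not> ?thesis"
    then have "(\<Sum>v\<in>pverts G. B v0 v * B v v0) = (\<Sum>v\<in>pverts G. if v = v0 then b * b else 0)"
      by (intro sum.cong) (auto simp: Bdiag)
    then have "d * b = b * b"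
      using v0 pair_finite_verts by (simp add: Bsq Bdiag)
    with b db assms(3) show False by simp
  qed
  then obtain v where v: "v \<in> pverts G" "v \<noteq> v0" "B v0 v \<noteq> 0" by blast
  have "\<bar>B v0 v\<bar> \<le> b"
    by (rule diagonal_ge_offdiagonal[OF pair_finite_verts v0 v(1) Bsym Bdiag[OF v0] Bdiag[OF v(1)] Bsq d])
  then have b2: "b \<ge> 2"
    using Boff[OF v0 v(1)] v by auto
  have "1 \<le> mu\<^sup>2"
    using assms(4) by simp
  also have "mu\<^sup>2 = r - m * b"
    using db by (simp add: d_def b_def algebra_simps)
  also have "\<dots> \<le> real r - m * 2"
    using b2 by (simp add: mult_left_mono)
  \<comment> \<open>\<open>1 \<le> r - 2 * m\<close> over the reals means
    \<open>r \<ge> 2 * m + 1\<close>, which is \<open>n - 1\<close> exactly, as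
    \<open>n \<ge> 2\<close>.\<close>
  finally have rn: "r \<ge> n - 1"
    using n by linarith
  have nbrs: "nbrs G u = pverts G - {u}" if "u \<in> pverts G" for u
    using that nbrs_subset[OF G, of u] rn pair_finite_verts
    by (intro card_seteq) (auto simp: reg card)
  \<comment> \<open>In a complete graph all the other \<open>n - 2 = 2 * m\<close> vertices are
    common neighbours of \<open>v0\<close> and \<open>v\<close>; this number is 0 or 2, and
    \<open>m \<ge> 1\<close> excludes 0.\<close>
  have "common_neighbours G v0 v = pverts G - {v0, v}"
    using nbrs[OF v0] nbrs[OF v(1)] by (auto simp: common_neighbours_def)
  then have "card (common_neighbours G v0 v) = 2 * m"
    using v0 v card n pair_finite_verts by (simp add: card_Diff_subset)
  with card_common_neighbours[OF G v0 v(1)] v(2) assms(3) have "m = 1" by auto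
  moreover have "parcs G = {(u, v). (u, v) \<in> pverts G \<times> pverts G \<and> u \<noteq> v}"
    using nbrs wellformed' by fastforce
  ultimately show ?thesis
    using pair_finite_verts by (simp add: complete_digraph_pair_def card n)
qed

end
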